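(* If $G$ is a connected graph with at least $5$ vertices and $\mu_5(G)=\dfrac{3+\sqrt{17}}{2}$, then $\mu_6(G)=4$.
   Context: All graphs are finite, undirected, simple and connected. The distance matrix $\mathcal{D}(G)$ of a graph $G$ on vertices $1,\dots,n$ is the $n\times n$ matrix whose $(i,j)$ entry is the length of a shortest path from $i$ to $j$. A real number $\lambda$ is a Pareto eigenvalue of a real $n\times n$ matrix $A$ if there is a nonzero vector $\mathbf{x}\in\mathbb{R}^n$, $\mathbf{x}\ge 0$ (entrywise), with $A\mathbf{x}\ge\lambda\mathbf{x}$ (entrywise) and $\lambda=\frac{\mathbf{x}^TA\mathbf{x}}{\mathbf{x}^T\mathbf{x}}$. The distance Pareto eigenvalues of $G$ are the Pareto eigenvalues of $\mathcal{D}(G)$. $\mu_k(G)$ denotes the $k$-th smallest element of the set of distinct distance Pareto eigenvalues of $G$. *)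

theory Defs
  imports "HOL-Analysis.Analysis" "Graph_Theory.Graph_Theory"
begin

text \<open>
  Finite simple graphs are taken from the library in the form of the locale \<open>pair_graph\<close>:
  finite, loop-free digraphs without parallel arcs whose arc relation is symmetric, an undirected
  edge being the pair of its two orientations. The vertex set is the universe of a finite type
  \<open>'n\<close>, which indexes the rows and columns of the distance matrix.
\<close>

text \<open>
  \<open>apath\<close> requires its vertices to be distinct. The value is meaningful only if some path from
  \<open>u\<close> to \<open>v\<close> exists, hence for all pairs of vertices of a connected graph.
\<close>

definition graph_dist :: "'a pair_pre_digraph \<Rightarrow> 'a \<Rightarrow> 'a \<Rightarrow> nat" where
  "graph_dist G u v = (LEAST k. \<exists>p. pre_digraph.apath (with_proj G) u p v \<and> length p = k)"

text \<open>It is the library's weighted distance for unit weights.\<close>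

lemma graph_dist_conv_mu:
  assumes "pair_graph G" and "Digraph_Component.connected (with_proj G)"
    and "u \<in> pverts G" and "v \<in> pverts G"
  shows "wf_digraph.\<mu> (with_proj G) (\<lambda>_. 1) u v = ereal (real (graph_dist G u v))"
proof -
  interpret pair_graph G by fact
  have cost: "awalk_cost (\<lambda>_. 1) p = real (length p)" for p :: "('a \<times> 'a) list"
    by (induction p) auto
  have "strongly_connected (with_proj G)"
    using symmetric_connected_imp_strongly_connected pair_sym_arcs assms(2) by blast
  then have "u \<rightarrow>\<^sup>*\<^bsub>with_proj G\<^esub> v"
    using assms(3,4) by (simp add: strongly_connected_def)
  then obtain q where q: "apath u q v"
    using reachable_apath by blast
  define P where "P k \<longleftrightarrow> (\<exists>p. apath u p v \<and> length p = k)" for k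
  have d: "graph_dist G u v = (LEAST k. P k)"
    by (simp add: graph_dist_def P_def)
  have "P (length q)" using q by (auto simp: P_def)
  then have "P (graph_dist G u v)" unfolding d by (rule LeastI)
  then obtain p where p: "apath u p v" "length p = graph_dist G u v" by (auto simp: P_def)
  have "graph_dist G u v \<le> length r" if r: "awalk u r v" for r
  proof -
    have "apath u (awalk_to_apath r) v" using apath_awalk_to_apath[OF r] .
    then have "graph_dist G u v \<le> length (awalk_to_apath r)"
      unfolding d by (intro Least_le) (auto simp: P_def)
    also have "\<dots> \<le> length r"
      using r
    proof (induction rule: awalk_to_apath_induct)
      case (path p)
      then show ?case by (subst awalk_to_apath.simps) auto
    next
      case (decomp p q r s)
      then have "p = q @ r @ s" using awalk_cyc_decomp_has_prop[of u p v] by auto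
      with decomp show ?case using step_awalk_to_apath[of u p v q r s] by auto
    qed
    finally show ?thesis .
  qed
  then show ?thesis
    unfolding \<mu>_def cost using p awalkI_apath[OF p(1)]
    by (intro INF_eqI) (auto, metis)
qed

definition distance_matrix :: "'n::finite pair_pre_digraph \<Rightarrow> real^'n^'n" where
  "distance_matrix G = (\<chi> i j. real (graph_dist G i j))"

text \<open>The order on \<open>real^'n\<close> is the entrywise one.\<close>

definition pareto_eigenvalue :: "real^'n^'n \<Rightarrow> real \<Rightarrow> bool" where
  "pareto_eigenvalue A l \<longleftrightarrow>
     (\<exists>x::real^'n. x \<noteq> 0 \<and> x \<ge> 0 \<and> A *v x \<ge> l *\<^sub>R x \<and> l = (x \<bullet> (A *v x)) / (x \<bullet> x))"

definition distance_pareto_eigenvalues :: "'n::finite pair_pre_digraph \<Rightarrow> real set" where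
  "distance_pareto_eigenvalues G = {l. pareto_eigenvalue (distance_matrix G) l}"

text \<open>
  Stated as a relation, since a set need not have a \<open>k\<close>-th smallest element; the positions are
  counted from 1. The finiteness condition is needed because \<open>card\<close> is 0 on infinite sets.
\<close>

definition kth_smallest :: "nat \<Rightarrow> 'a::linorder set \<Rightarrow> 'a \<Rightarrow> bool" where
  "kth_smallest k S m \<longleftrightarrow>
     m \<in> S \<and> finite {s \<in> S. s < m} \<and> card {s \<in> S. s < m} + 1 = k"

text \<open>\<open>is_mu G k l\<close> says that \<open>\<mu>\<^sub>k(G)\<close> exists and equals \<open>l\<close>.\<close>

definition is_mu :: "'n::finite pair_pre_digraph \<Rightarrow> nat \<Rightarrow> real \<Rightarrow> bool" where
  "is_mu G k l \<longleftrightarrow> kth_smallest k (distance_pareto_eigenvalues G) l"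

end

theory Submission
  imports Defs
begin

text \<open>
  The Pareto eigenvalues of a nonnegative matrix are the eigenvalues of its principal submatrices
  that have a positive eigenvector. For such a submatrix of a distance matrix, of order \<open>k\<close>, the
  eigenvalue is at least the average row sum, hence at least \<open>k - 1\<close>. So eigenvalues below 4 come
  from at most four vertices with few distances above 1, and the only ones are 0, 1, 2,
  \<open>1 + sqrt 3\<close>, 3, \<open>(1 + sqrt 33) / 2\<close> and \<open>(3 + sqrt 17) / 2\<close>, the last one arising only from
  \<open>K\<^sub>4\<close> minus an edge. As that subgraph also yields 0, 1, 2 and \<open>1 + sqrt 3\<close>, the hypothesis says that
  3 and \<open>(1 + sqrt 33) / 2\<close> do not occur. Therefore there are no distances above 2, no \<open>K\<^sub>4\<close>, and no
  three vertices spanning exactly one edge: the graph is complete tripartite. With a fifth vertex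
  it contains three mutually non-adjacent vertices or an induced four-cycle, either of which
  gives the eigenvalue 4.
\<close>

section \<open>Pareto eigenvalues and positive eigenvectors\<close>

text \<open>The nonnegative terms \<open>x $ i * ((A *v x) $ i - l * x $ i)\<close> sum to zero, so
  each vanishes and \<open>x\<close> satisfies the eigenvalue equation on its support. Conversely,
  \<open>f\<close> is extended by zero; outside \<open>S\<close> the inequality holds because
  \<open>A\<close> is nonnegative.\<close>

lemma pareto_eigenvalue_iff:
  fixes A :: "real^'n^'n"
  assumes nonneg: "\<And>i j. A $ i $ j \<ge> 0"
  shows "pareto_eigenvalue A l \<longleftrightarrow>
    (\<exists>S f. S \<noteq> {} \<and> (\<forall>i\<in>S. f i > 0) \<and> (\<forall>i\<in>S. (\<Sum>j\<in>S. A $ i $ j * f j) = l * f i))"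
    (is "?L \<longleftrightarrow> ?R")
proof
  assume ?L
  then obtain x :: "real^'n" where x: "x \<noteq> 0" "x \<ge> 0" "A *v x \<ge> l *\<^sub>R x"
    and l: "l = (x \<bullet> (A *v x)) / (x \<bullet> x)"
    by (auto simp: pareto_eigenvalue_def)
  have x0: "x $ i \<ge> 0" for i using x(2) by (simp add: less_eq_vec_def)
  have Ax: "(A *v x) $ i \<ge> l * x $ i" for i using x(3) by (simp add: less_eq_vec_def)
  have "x \<bullet> (A *v x) = l * (x \<bullet> x)" using l x(1) by (simp add: field_simps)
  then have "(\<Sum>i\<in>UNIV. x $ i * ((A *v x) $ i - l * x $ i)) = 0"
    by (simp add: inner_vec_def sum_distrib_left right_diff_distrib sum_subtractf mult.left_commute)
  then have compl: "x $ i * ((A *v x) $ i - l * x $ i) = 0" for i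
    using x0 Ax by (subst (asm) sum_nonneg_eq_0_iff) auto
  define S where "S = {i. x $ i > 0}"
  have outside: "x $ i = 0" if "i \<notin> S" for i
    using that x0[of i] by (simp add: S_def)
  have "S \<noteq> {}"
    using x(1) outside by (auto simp: vec_eq_iff)
  moreover have "(\<Sum>j\<in>S. A $ i $ j * x $ j) = l * x $ i" if "i \<in> S" for i
  proof -
    have "(\<Sum>j\<in>S. A $ i $ j * x $ j) = (A *v x) $ i"
      unfolding matrix_vector_mult_def by (simp, rule sum.mono_neutral_left) (auto simp: outside)
    also have "\<dots> = l * x $ i" using compl[of i] that by (simp add: S_def)
    finally show ?thesis .
  qed
  ultimately show ?R
    by (intro exI[of _ S] exI[of _ "\<lambda>i. x $ i"]) (auto simp: S_def)
next
  assume ?R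
  then obtain S f where S: "S \<noteq> {}" and pos: "\<And>i. i \<in> S \<Longrightarrow> f i > 0"
    and eig: "\<And>i. i \<in> S \<Longrightarrow> (\<Sum>j\<in>S. A $ i $ j * f j) = l * f i" by blast
  define x :: "real^'n" where "x = (\<chi> i. if i \<in> S then f i else 0)"
  have Ax: "(A *v x) $ i = (\<Sum>j\<in>S. A $ i $ j * f j)" for i
    unfolding matrix_vector_mult_def x_def
    by (simp add: if_distrib[of "\<lambda>y. _ * y"] sum.If_cases cong: if_cong)
  have x_nz: "x \<noteq> 0"
  proof -
    obtain i where "i \<in> S" using S by auto
    then have "x $ i \<noteq> 0" using pos[of i] by (simp add: x_def)
    then show ?thesis by auto
  qed
  have "x \<ge> 0"
    using pos by (auto simp: less_eq_vec_def x_def less_imp_le)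
  moreover have "A *v x \<ge> l *\<^sub>R x"
    unfolding less_eq_vec_def
  proof
    fix i
    show "(l *\<^sub>R x) $ i \<le> (A *v x) $ i"
      using nonneg pos by (cases "i \<in> S") (auto simp: Ax eig, auto simp: x_def less_imp_le intro!: sum_nonneg)
  qed
  moreover have "x \<bullet> (A *v x) = l * (x \<bullet> x)"
  proof -
    have "x $ i * (A *v x) $ i = l * (x $ i * x $ i)" for i
      by (cases "i \<in> S") (auto simp: Ax eig, auto simp: x_def)
    then show ?thesis by (simp only: inner_vec_def sum_distrib_left inner_real_def)
  qed
  ultimately show ?L
    unfolding pareto_eigenvalue_def using x_nz by (intro exI[of _ x]) auto
qed

text \<open>
  AM-GM for the ratios \<open>f j / f i\<close> and \<open>f i / f j\<close>.
\<close>

lemma positive_eigenvector_sum_le: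
  fixes a :: "'a \<Rightarrow> 'a \<Rightarrow> real"
  assumes nonneg: "\<And>i j. a i j \<ge> 0" and sym: "\<And>i j. a i j = a j i"
    and pos: "\<And>i. i \<in> S \<Longrightarrow> f i > 0"
    and eig: "\<And>i. i \<in> S \<Longrightarrow> (\<Sum>j\<in>S. a i j * f j) = l * f i"
  shows "(\<Sum>i\<in>S. \<Sum>j\<in>S. a i j) \<le> l * card S"
proof -
  \<comment> \<open>Conjugating by the diagonal matrix of \<open>f\<close> makes every row sum equal
    to \<open>l\<close>.\<close>
  define r where "r i j = a i j * (f j / f i)" for i j
  have "(\<Sum>j\<in>S. r i j) = l" if "i \<in> S" for i
  proof -
    have "(\<Sum>j\<in>S. r i j) = (\<Sum>j\<in>S. a i j * f j) / f i"
      by (simp add: r_def sum_divide_distrib)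
    with eig[OF that] pos[OF that] show ?thesis by simp
  qed
  then have rows: "(\<Sum>i\<in>S. \<Sum>j\<in>S. r i j) = l * card S" by simp
  have "(\<Sum>i\<in>S. \<Sum>j\<in>S. r j i) = l * card S"
    by (subst sum.swap) (rule rows)
  then have "(\<Sum>i\<in>S. \<Sum>j\<in>S. r i j + r j i) = 2 * (l * card S)"
    by (simp add: sum.distrib rows)
  moreover have "(\<Sum>i\<in>S. \<Sum>j\<in>S. 2 * a i j) \<le> (\<Sum>i\<in>S. \<Sum>j\<in>S. r i j + r j i)"
  proof (intro sum_mono)
    fix i j assume ij: "i \<in> S" "j \<in> S"
    have "2 \<le> f j / f i + f i / f j"
      using pos[OF ij(1)] pos[OF ij(2)] sum_squares_bound[of "f i" "f j"]
      by (simp add: field_simps power2_eq_square)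
    then have "a i j * 2 \<le> a i j * (f j / f i + f i / f j)"
      using nonneg by (rule mult_left_mono)
    then show "2 * a i j \<le> r i j + r j i"
      by (simp add: r_def sym[of j i] distrib_left mult.commute)
  qed
  ultimately show ?thesis by (simp flip: sum_distrib_left)
qed

section \<open>Eigenvalues of small distance matrices\<close>

text \<open>The roots of \<open>t * t = p * t + q\<close> have product \<open>- q < 0\<close>, so
  only one is positive. Eliminating \<open>p\<close> between the two equations gives the
  factorisation.\<close>

lemma quadratic_root_unique:
  fixes l :: real
  assumes "l > 0" "l * l = p * l + q" "r > 0" "r * r = p * r + q" "q > 0"
  shows "l = r"
proof -
  have "(l - r) * (l * r + q) = 0"
    using assms(2,4) by algebra
  moreover have "l * r + q > 0" using assms by (simp add: add_pos_pos)
  ultimately show ?thesis by simp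
qed

text \<open>The digits are the three distances; \<open>a\<close> and \<open>b\<close> belong to the
  ends of a path. Subtracting their equations forces equal entries, and eliminating \<open>c\<close>
  leaves a quadratic for \<open>l\<close>.\<close>

lemma perron_root_112:
  fixes l a b c :: real
  assumes "a > 0" "b > 0" "c > 0" "l \<ge> 0"
    "2 * b + c = l * a" "2 * a + c = l * b" "a + b = l * c"
  shows "l = 1 + sqrt 3"
proof -
  have l: "l > 0" using assms by (cases "l = 0") auto
  have "(l + 2) * (a - b) = 0" using assms(5,6) by algebra
  then have ab: "b = a" using l by simp
  have "a * (l * l) = a * (2 * l + 2)" using assms(5,7) unfolding ab by algebra
  then have "l * l = 2 * l + 2" using assms(1) by simp
  then show ?thesis
    by (rule quadratic_root_unique[OF l]) (auto simp: algebra_simps add_pos_pos)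
qed

lemma perron_root_122:
  fixes l a b c :: real
  assumes "a > 0" "b > 0" "c > 0" "l \<ge> 0"
    "b + 2 * c = l * a" "a + 2 * c = l * b" "2 * a + 2 * b = l * c"
  shows "l = (1 + sqrt 33) / 2"
proof -
  have l: "l > 0" using assms by (cases "l = 0") auto
  have "(l + 1) * (a - b) = 0" using assms(5,6) by algebra
  then have ab: "b = a" using l by simp
  \<comment> \<open>The factor 1 gives the right-hand side the shape
    \<open>p * l + q\<close>.\<close>
  have "a * (l * l) = a * (1 * l + 8)" using assms(5,7) unfolding ab by algebra
  then have "l * l = 1 * l + 8" using assms(1) by simp
  then show ?thesis
    by (rule quadratic_root_unique[OF l]) (auto simp: field_simps add_pos_pos)
qed

text \<open>There are two pairs of twins: the ends \<open>a\<close>, \<open>b\<close> of the missing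
  edge, and \<open>c\<close>, \<open>e\<close>. Twins have equal entries, so two unknowns and a
  quadratic remain.\<close>

lemma perron_root_K4_minus_edge:
  fixes l a b c e :: real
  assumes "a > 0" "b > 0" "c > 0" "e > 0" "l \<ge> 0"
    "2 * b + c + e = l * a" "2 * a + c + e = l * b" "a + b + e = l * c" "a + b + c = l * e"
  shows "l = (3 + sqrt 17) / 2"
proof -
  have l: "l > 0" using assms by (cases "l = 0") auto
  have "(l + 2) * (a - b) = 0" using assms(6,7) by algebra
  then have ab: "b = a" using l by simp
  have "(l + 1) * (c - e) = 0" using assms(8,9) by algebra
  then have ce: "e = c" using l by simp
  have "a * (l * l) = a * (3 * l + 2)" using assms(6,8) unfolding ab ce by algebra
  then have "l * l = 3 * l + 2" using assms(1) by simp
  then show ?thesis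
    by (rule quadratic_root_unique[OF l]) (auto simp: field_simps add_pos_pos)
qed

section \<open>Three or four vertices with small distance sum\<close>

text \<open>By the triangle inequality twice the largest distance is at most the sum, hence at most
  5; so every distance is 1 or 2.\<close>

lemma three_distances_cases:
  fixes p q r :: nat
  assumes "p \<ge> 1" "q \<ge> 1" "r \<ge> 1" "p + q + r < 6"
    and "p \<le> q + r" "q \<le> p + r" "r \<le> p + q"
  obtains "p = 1" "q = 1" "r = 1"
    | "p = 2" "q = 1" "r = 1" | "p = 1" "q = 2" "r = 1" | "p = 1" "q = 1" "r = 2"
    | "p = 1" "q = 2" "r = 2" | "p = 2" "q = 1" "r = 2" | "p = 2" "q = 2" "r = 1"
proof -
  have "p = 1 \<or> p = 2" "q = 1 \<or> q = 2" "r = 1 \<or> r = 2" using assms by linarith+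
  moreover have "\<not> (p = 2 \<and> q = 2 \<and> r = 2)" using assms(4) by linarith
  ultimately show ?thesis using that by blast
qed

text \<open>A sum of at most 7 leaves a single unit to distribute beyond the six ones.\<close>

lemma six_distances_cases:
  fixes p q r s t u :: nat
  assumes ge: "p \<ge> 1" "q \<ge> 1" "r \<ge> 1" "s \<ge> 1" "t \<ge> 1" "u \<ge> 1"
    and sum: "p + q + r + s + t + u < 8"
  obtains "p = 1" "q = 1" "r = 1" "s = 1" "t = 1" "u = 1"
    | "p = 2" "q = 1" "r = 1" "s = 1" "t = 1" "u = 1"
    | "p = 1" "q = 2" "r = 1" "s = 1" "t = 1" "u = 1"
    | "p = 1" "q = 1" "r = 2" "s = 1" "t = 1" "u = 1"
    | "p = 1" "q = 1" "r = 1" "s = 2" "t = 1" "u = 1"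
    | "p = 1" "q = 1" "r = 1" "s = 1" "t = 2" "u = 1"
    | "p = 1" "q = 1" "r = 1" "s = 1" "t = 1" "u = 2"
proof -
  consider "p \<noteq> 1" | "q \<noteq> 1" | "r \<noteq> 1" | "s \<noteq> 1" | "t \<noteq> 1" | "u \<noteq> 1"
    | "p = 1" "q = 1" "r = 1" "s = 1" "t = 1" "u = 1" by blast
  then show ?thesis
  proof cases
    case 1
    then have "p = 2" "q = 1" "r = 1" "s = 1" "t = 1" "u = 1"
      using assms by linarith+
    then show ?thesis by (rule that)
  next
    case 2
    then have "p = 1" "q = 2" "r = 1" "s = 1" "t = 1" "u = 1"
      using assms by linarith+
    then show ?thesis by (rule that)
  next
    case 3
    then have "p = 1" "q = 1" "r = 2" "s = 1" "t = 1" "u = 1"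
      using assms by linarith+
    then show ?thesis by (rule that)
  next
    case 4
    then have "p = 1" "q = 1" "r = 1" "s = 2" "t = 1" "u = 1"
      using assms by linarith+
    then show ?thesis by (rule that)
  next
    case 5
    then have "p = 1" "q = 1" "r = 1" "s = 1" "t = 2" "u = 1"
      using assms by linarith+
    then show ?thesis by (rule that)
  next
    case 6
    then have "p = 1" "q = 1" "r = 1" "s = 1" "t = 1" "u = 2"
      using assms by linarith+
    then show ?thesis by (rule that)
  next
    case 7
    then show ?thesis by (rule that)
  qed
qed

section \<open>Graph metrics and eigenvalues of small configurations\<close>

text \<open>This is what the spectral argument uses of a connected graph. With \<open>step\<close>,
  the integer-valued metric \<open>d\<close> is the path metric of the graph whose edges are the
  pairs at distance 1.\<close>

locale graph_metric =
  fixes d :: "'n::finite \<Rightarrow> 'n \<Rightarrow> nat"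
  assumes eq_0_iff [simp]: "d u v = 0 \<longleftrightarrow> u = v"
    and sym: "d u v = d v u"
    and triangle: "d u w \<le> d u v + d v w"
    and step: "d u v = Suc k \<Longrightarrow> \<exists>w. d u w = 1 \<and> d w v = k"
begin

lemma dist_self [simp]: "d u u = 0"
  by simp

lemma pos_iff [simp]: "0 < d u v \<longleftrightarrow> u \<noteq> v"
  by (metis eq_0_iff neq0_conv)

definition spectrum :: "real set" where
  "spectrum = {l. pareto_eigenvalue (\<chi> i j. real (d i j)) l}"

lemma spectrum_iff:
  "l \<in> spectrum \<longleftrightarrow>
    (\<exists>S f. S \<noteq> {} \<and> (\<forall>i\<in>S. f i > 0) \<and> (\<forall>i\<in>S. (\<Sum>j\<in>S. real (d i j) * f j) = l * f i))"
  unfolding spectrum_def by (simp add: pareto_eigenvalue_iff)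

lemma constant_row_sum_in_spectrum:
  assumes "S \<noteq> {}" "\<And>i. i \<in> S \<Longrightarrow> (\<Sum>j\<in>S. d i j) = k"
  shows "real k \<in> spectrum"
  unfolding spectrum_iff using assms
  by (intro exI[of _ S] exI[of _ "\<lambda>_. 1"]) (auto simp flip: of_nat_sum)

text \<open>The all-ones vector on \<open>{a, b}\<close> works; the case \<open>a = b\<close>
  supplies the eigenvalue 0.\<close>

lemma dist_in_spectrum: "real (d a b) \<in> spectrum"
  by (cases "a = b"; rule constant_row_sum_in_spectrum[of "{a, b}"]) (auto simp: sym[of b a])

lemma triple_222_in_spectrum:
  assumes "d a b = 2" "d a c = 2" "d b c = 2"
  shows "4 \<in> spectrum"
proof -
  have "a \<noteq> b" "a \<noteq> c" "b \<noteq> c" using assms eq_0_iff by (metis zero_neq_numeral)+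
  then have "real 4 \<in> spectrum"
    using assms by (intro constant_row_sum_in_spectrum[of "{a, b, c}"]) (auto simp: sym[of b a] sym[of c a] sym[of c b])
  then show ?thesis by simp
qed

lemma triple_112_in_spectrum:
  assumes "d a b = 2" "d a c = 1" "d b c = 1"
  shows "1 + sqrt 3 \<in> spectrum"
proof -
  have ne: "a \<noteq> b" "a \<noteq> c" "b \<noteq> c" using assms eq_0_iff by (metis zero_neq_numeral zero_neq_one)+
  \<comment> \<open>With entries 1, 1, t the first row gives \<open>2 + t = l\<close>, so t is
    \<open>sqrt 3 - 1\<close>.\<close>
  have "(\<Sum>j\<in>{a, b, c}. real (d i j) * (if j = c then sqrt 3 - 1 else 1))
      = (1 + sqrt 3) * (if i = c then sqrt 3 - 1 else 1)" if "i \<in> {a, b, c}" for i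
    using that ne assms by (auto simp: sym[of b a] sym[of c a] sym[of c b] algebra_simps)
  then show ?thesis
    unfolding spectrum_iff
    by (intro exI[of _ "{a, b, c}"] exI[of _ "\<lambda>j. if j = c then sqrt 3 - 1 else 1"]) auto
qed

lemma triple_122_in_spectrum:
  assumes "d a b = 1" "d a c = 2" "d b c = 2"
  shows "(1 + sqrt 33) / 2 \<in> spectrum"
proof -
  \<comment> \<open>With entries 2, 2, t the first row gives \<open>2 + 2 * t = 2 * l\<close>, so t
    is \<open>l - 1\<close>.\<close>
  define f where "f j = (if j = c then (sqrt 33 - 1) / 2 else 2)" for j
  have ne: "a \<noteq> b" "a \<noteq> c" "b \<noteq> c" using assms eq_0_iff by (metis zero_neq_numeral zero_neq_one)+
  have "(\<Sum>j\<in>{a, b, c}. real (d i j) * f j) = (1 + sqrt 33) / 2 * f i" if "i \<in> {a, b, c}" for i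
    using that ne assms by (auto simp: f_def sym[of b a] sym[of c a] sym[of c b] field_simps)
  then show ?thesis
    unfolding spectrum_iff
    by (intro exI[of _ "{a, b, c}"] exI[of _ f]) (auto simp: f_def)
qed

lemma K4_in_spectrum:
  assumes "d a b = 1" "d a c = 1" "d a e = 1" "d b c = 1" "d b e = 1" "d c e = 1"
  shows "3 \<in> spectrum"
proof -
  have "a \<noteq> b" "a \<noteq> c" "a \<noteq> e" "b \<noteq> c" "b \<noteq> e" "c \<noteq> e"
    using assms eq_0_iff by (metis zero_neq_one)+
  then have "real 3 \<in> spectrum"
    using assms by (intro constant_row_sum_in_spectrum[of "{a, b, c, e}"])
      (auto simp: sym[of b a] sym[of c a] sym[of c b] sym[of e a] sym[of e b] sym[of e c])
  then show ?thesis by simp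
qed

lemma C4_in_spectrum:
  assumes "d a b = 2" "d a c = 1" "d a e = 1" "d b c = 1" "d b e = 1" "d c e = 2"
  shows "4 \<in> spectrum"
proof -
  have "a \<noteq> b" "a \<noteq> c" "a \<noteq> e" "b \<noteq> c" "b \<noteq> e" "c \<noteq> e"
    using assms eq_0_iff by (metis zero_neq_one zero_neq_numeral)+
  then have "real 4 \<in> spectrum"
    using assms by (intro constant_row_sum_in_spectrum[of "{a, b, c, e}"])
      (auto simp: sym[of b a] sym[of c a] sym[of c b] sym[of e a] sym[of e b] sym[of e c])
  then show ?thesis by simp
qed

text \<open>A shortest path longer than 3 passes through a vertex at distance exactly 3 from its
  end, and every distance is an eigenvalue.\<close>

lemma dist_le_2:
  assumes "3 \<notin> spectrum"
  shows "d u v \<le> 2"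
proof (rule ccontr)
  assume "\<not> d u v \<le> 2"
  then have "\<exists>w. d w v = 3"
  proof (induction "d u v" arbitrary: u)
    case (Suc k)
    then obtain w where "d w v = k" using step by metis
    \<comment> \<open>If \<open>k = 2\<close>, then \<open>u\<close> itself is at distance 3;
      otherwise the induction hypothesis applies to \<open>w\<close>.\<close>
    with Suc show ?case by (cases "k = 2") force+
  qed simp
  with assms dist_in_spectrum show False by (metis of_nat_numeral)
qed

text \<open>The six distances are nonzero, which makes the four vertices distinct.\<close>

definition K4_minus_edge :: bool where
  "K4_minus_edge \<longleftrightarrow> (\<exists>a b c e. d a b = 2 \<and> d a c = 1 \<and> d a e = 1 \<and> d b c = 1 \<and> d b e = 1 \<and> d c e = 1)"

section \<open>Classification of the eigenvalues below 4\<close>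

text \<open>The average row sum is at most \<open>l < 4\<close>, which bounds the sum of distances
  on the support and leaves finitely many matrices. The second disjunct recovers structure from the
  eigenvalue.\<close>

lemma spectrum_below_4:
  assumes "l \<in> spectrum" "l < 4"
  shows "l \<in> {0, 1, 2, 3, 1 + sqrt 3, (1 + sqrt 33) / 2} \<or> l = (3 + sqrt 17) / 2 \<and> K4_minus_edge"
proof -
  obtain S f where S: "S \<noteq> {}" and pos: "\<And>i. i \<in> S \<Longrightarrow> f i > 0"
    and eig: "\<And>i. i \<in> S \<Longrightarrow> (\<Sum>j\<in>S. real (d i j) * f j) = l * f i"
    using assms(1) unfolding spectrum_iff by blast
  have le: "(\<Sum>i\<in>S. \<Sum>j\<in>S. real (d i j)) \<le> l * card S"
    by (rule positive_eigenvector_sum_le[OF _ _ pos eig]) (auto intro: sym)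
  have card_pos: "card S > 0" using S by (simp add: card_gt_0_iff)
  have row: "real (card S) - 1 \<le> (\<Sum>j\<in>S. real (d i j))" if "i \<in> S" for i
  proof -
    have "real (card S) - 1 = (\<Sum>j\<in>S - {i}. 1)"
      using that card_pos by (simp add: card_Diff_singleton of_nat_diff Suc_leI)
    also have "\<dots> \<le> (\<Sum>j\<in>S - {i}. real (d i j))"
    proof (rule sum_mono)
      fix j assume "j \<in> S - {i}"
      then have "d i j \<noteq> 0" by auto
      then show "1 \<le> real (d i j)" by linarith
    qed
    also have "\<dots> \<le> (\<Sum>j\<in>S. real (d i j))" by (rule sum_mono2) auto
    finally show ?thesis .
  qed
  have "(real (card S) - 1) * card S \<le> (\<Sum>i\<in>S. \<Sum>j\<in>S. real (d i j))"
    using sum_mono[of S "\<lambda>_. real (card S) - 1", OF row] by (simp add: mult.commute)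
  with le have "(real (card S) - 1) * card S \<le> l * card S" by simp
  then have l_ge: "real (card S) - 1 \<le> l" using card_pos by simp
  then have l0: "l \<ge> 0" using card_pos by linarith
  have "card S < 5" using l_ge assms(2) by linarith
  then consider "card S = 1" | "card S = 2" | "card S = 3" | "card S = 4"
    using card_pos by linarith
  then show ?thesis
  proof cases
    case 1
    then obtain a where "S = {a}" by (auto simp: card_1_singleton_iff)
    with eig[of a] pos[of a] show ?thesis by simp
  next
    case 2
    then obtain a b where ab: "S = {a, b}" "a \<noteq> b" by (auto simp: card_2_iff)
    have "real (d a b) \<le> l"
      using le ab by (simp add: sym[of b a])
    then have "d a b < 4" using assms(2) by linarith
    then have cases: "d a b \<in> {1, 2, 3}" using ab by (auto simp: numeral_eq_Suc less_Suc_eq)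
    have e: "real (d a b) * f b = l * f a" "real (d a b) * f a = l * f b"
      using eig[of a] eig[of b] ab by (auto simp: sym[of b a])
    have "(l + real (d a b)) * (f a - f b) = 0" using e by algebra
    moreover have "l + real (d a b) > 0" using l0 cases by auto
    ultimately have "f a = f b" by simp
    with e pos[of a] ab have "l = real (d a b)" by simp
    with cases show ?thesis by auto
  next
    case 3
    then obtain a b c where abc: "S = {a, b, c}" "a \<noteq> b" "a \<noteq> c" "b \<noteq> c" by (auto simp: card_3_iff)
    \<comment> \<open>Each pair occurs in two rows, hence the factor 2.\<close>
    have "real (2 * (d a b + d a c + d b c)) \<le> l * 3"
      using le abc by (simp add: sym[of b a] sym[of c a] sym[of c b])
    then have "real (2 * (d a b + d a c + d b c)) < real 12" using assms(2) by simp
    then have small: "d a b + d a c + d b c < 6" unfolding of_nat_less_iff by simp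
    have tri: "d a b \<le> d a c + d b c" "d a c \<le> d a b + d b c" "d b c \<le> d a b + d a c"
      using triangle[of a b c] triangle[of a c b] triangle[of b c a] by (simp_all add: sym[of c b] sym[of b a])
    have nz: "d a b \<ge> 1" "d a c \<ge> 1" "d b c \<ge> 1" using abc by (simp_all add: Suc_le_eq)
    have e: "real (d a b) * f b + real (d a c) * f c = l * f a"
      "real (d a b) * f a + real (d b c) * f c = l * f b"
      "real (d a c) * f a + real (d b c) * f b = l * f c"
      using eig[of a] eig[of b] eig[of c] abc by (auto simp: sym[of b a] sym[of c a] sym[of c b])
    have p: "f a > 0" "f b > 0" "f c > 0" using pos abc by auto
    from nz small tri show ?thesis
    proof (cases rule: three_distances_cases)
      case 1
      with e have "l * (f a + f b + f c) = 2 * (f a + f b + f c)" unfolding distrib_left by simp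
      moreover have "f a + f b + f c \<noteq> 0" using p by linarith
      ultimately have "l = 2" by (metis mult_cancel_right)
      then show ?thesis by simp
    next
      case 2
      \<comment> \<open>Here and below, the pair whose distance differs from the other two comes
        first.\<close>
      with e p l0 perron_root_112[of "f a" "f b" "f c" l] show ?thesis by simp
    next
      case 3
      with e p l0 perron_root_112[of "f a" "f c" "f b" l] show ?thesis by (simp add: add.commute)
    next
      case 4
      with e p l0 perron_root_112[of "f b" "f c" "f a" l] show ?thesis by (simp add: add.commute)
    next
      case 5
      with e p l0 perron_root_122[of "f a" "f b" "f c" l] show ?thesis by simp
    next
      case 6
      with e p l0 perron_root_122[of "f a" "f c" "f b" l] show ?thesis by (simp add: add.commute)
    next
      case 7
      with e p l0 perron_root_122[of "f b" "f c" "f a" l] show ?thesis by (simp add: add.commute)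
    qed
  next
    case 4
    then obtain a T where aT: "S = insert a T" "a \<notin> T" "card T = 3"
      using card_Suc_eq[of S 3] by auto
    obtain b c e where "T = {b, c, e}" "b \<noteq> c" "b \<noteq> e" "c \<noteq> e"
      using aT(3) by (auto simp: card_3_iff)
    with aT have v: "S = {a, b, c, e}" "a \<noteq> b" "a \<noteq> c" "a \<noteq> e" "b \<noteq> c" "b \<noteq> e" "c \<noteq> e" by auto
    note syms = sym[of b a] sym[of c a] sym[of c b] sym[of e a] sym[of e b] sym[of e c]
    have "real (2 * (d a b + d a c + d a e + d b c + d b e + d c e)) \<le> l * 4"
      using le v by (simp add: syms)
    then have "real (2 * (d a b + d a c + d a e + d b c + d b e + d c e)) < real 16" using assms(2) by simp
    then have small: "d a b + d a c + d a e + d b c + d b e + d c e < 8" unfolding of_nat_less_iff by simp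
    have nz: "d a b \<ge> 1" "d a c \<ge> 1" "d a e \<ge> 1" "d b c \<ge> 1" "d b e \<ge> 1" "d c e \<ge> 1"
      using v by (simp_all add: Suc_le_eq)
    have eqs: "real (d a b) * f b + real (d a c) * f c + real (d a e) * f e = l * f a"
      "real (d a b) * f a + real (d b c) * f c + real (d b e) * f e = l * f b"
      "real (d a c) * f a + real (d b c) * f b + real (d c e) * f e = l * f c"
      "real (d a e) * f a + real (d b e) * f b + real (d c e) * f c = l * f e"
      using eig[of a] eig[of b] eig[of c] eig[of e] v by (auto simp: syms)
    have p: "f a > 0" "f b > 0" "f c > 0" "f e > 0" using pos v by auto
    \<comment> \<open>Stated for arbitrary vertices, so that all six positions of the missing edge
      \<open>x\<close>, \<open>y\<close> follow by relabelling.\<close>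
    have diamond: "l = (3 + sqrt 17) / 2 \<and> K4_minus_edge"
      if "d x y = 2" "d x z = 1" "d x w = 1" "d y z = 1" "d y w = 1" "d z w = 1"
        "2 * f y + f z + f w = l * f x" "2 * f x + f z + f w = l * f y"
        "f x + f y + f w = l * f z" "f x + f y + f z = l * f w"
        "f x > 0" "f y > 0" "f z > 0" "f w > 0" for x y z w
      using that l0 perron_root_K4_minus_edge[of "f x" "f y" "f z" "f w" l]
      unfolding K4_minus_edge_def by blast
    from nz small show ?thesis
    proof (cases rule: six_distances_cases)
      case 1
      with eqs have "l * (f a + f b + f c + f e) = 3 * (f a + f b + f c + f e)" unfolding distrib_left by simp
      moreover have "f a + f b + f c + f e \<noteq> 0" using p by linarith
      ultimately have "l = 3" by (metis mult_cancel_right)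
      then show ?thesis by simp
    next
      case 2
      with eqs p diamond[of a b c e] show ?thesis by (simp add: syms)
    next
      case 3
      with eqs p diamond[of a c b e] show ?thesis by (simp add: syms add_ac)
    next
      case 4
      with eqs p diamond[of a e b c] show ?thesis by (simp add: syms add_ac)
    next
      case 5
      with eqs p diamond[of b c a e] show ?thesis by (simp add: syms add_ac)
    next
      case 6
      with eqs p diamond[of b e a c] show ?thesis by (simp add: syms add_ac)
    next
      case 7
      with eqs p diamond[of c e a b] show ?thesis by (simp add: syms add_ac)
    qed
  qed
qed

section \<open>Forcing the eigenvalue 4 with a fifth vertex\<close>

lemma four_in_spectrum:
  assumes "K4_minus_edge" "CARD('n) \<ge> 5" "3 \<notin> spectrum" "(1 + sqrt 33) / 2 \<notin> spectrum"
  shows "4 \<in> spectrum"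
proof -
  obtain a b c e where D: "d a b = 2" "d a c = 1" "d a e = 1" "d b c = 1" "d b e = 1" "d c e = 1"
    using assms(1) unfolding K4_minus_edge_def by blast
  have "card {a, b, c, e} \<le> 4"
    by (rule order.trans[OF card_insert_le_m1[of 4]]) (auto simp: card_insert_if)
  then have "{a, b, c, e} \<noteq> UNIV" using assms(2) by auto
  then obtain v where v: "v \<notin> {a, b, c, e}" by blast
  have dist: "d x y = 1 \<or> d x y = 2" if "x \<noteq> y" for x y
  proof -
    have "d x y \<noteq> 0" using that by simp
    with dist_le_2[OF assms(3), of x y] show ?thesis by linarith
  qed
  \<comment> \<open>Otherwise \<open>x\<close>, \<open>z\<close> would be the only edge among the
    three vertices, giving the excluded \<open>(1 + sqrt 33) / 2\<close>.\<close>
  have trans: "d x z = 2" if "d x y = 2" "d y z = 2" "x \<noteq> z" for x y z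
  proof (rule ccontr)
    assume "d x z \<noteq> 2"
    then have "d x z = 1" using dist[OF that(3)] by simp
    then have "(1 + sqrt 33) / 2 \<in> spectrum"
      using triple_122_in_spectrum[of x z y] that by (simp add: sym[of z y])
    with assms(4) show False by simp
  qed
  \<comment> \<open>If \<open>v\<close> were at distance 2 from \<open>a\<close> or
    \<open>b\<close>, transitivity through \<open>v\<close> would put that vertex at distance 2 from
    \<open>c'\<close>. So there is a four-cycle with diagonals \<open>a\<close>, \<open>b\<close>
    and \<open>v\<close>, \<open>c'\<close>.\<close>
  have four: "4 \<in> spectrum" if "d v c' = 2" "d a c' = 1" "d b c' = 1" for c'
  proof -
    have "a \<noteq> c'" "b \<noteq> c'" using that by auto
    then have "d v a = 1" "d v b = 1"
      using dist[of v a] dist[of v b] v trans[of a v c'] trans[of b v c'] that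
      by (auto simp: sym[of v a] sym[of v b])
    then show ?thesis
      using C4_in_spectrum[of a b v c'] D that by (simp add: sym[of v a] sym[of v b] sym[of v c'])
  qed
  \<comment> \<open>Otherwise \<open>v\<close>, \<open>a\<close>, \<open>c\<close>, \<open>e\<close>
    would span a complete graph, with eigenvalue 3.\<close>
  have "d v a = 2 \<or> d v c = 2 \<or> d v e = 2"
    using dist[of v a] dist[of v c] dist[of v e] v K4_in_spectrum[of v a c e] assms(3) D by auto
  then show ?thesis
  proof (elim disjE)
    assume "d v a = 2"
    with trans[of v a b] v D have "d v b = 2" by simp
    with \<open>d v a = 2\<close> D show ?thesis by (intro triple_222_in_spectrum[of v a b])
  qed (use four D in \<open>auto simp: sym[of e c]\<close>)
qed

end

section \<open>Graph distances as a graph metric\<close>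

text \<open>The argument uses walks, since joining two paths need not give a path. The library
  distance is an infimum over all walks, so any walk bounds \<open>graph_dist\<close> from
  above.\<close>

lemma graph_metric_graph_dist:
  fixes G :: "'n::finite pair_pre_digraph"
  assumes "pair_graph G" and V: "pverts G = UNIV" and con: "Digraph_Component.connected (with_proj G)"
  shows "graph_metric (graph_dist G)"
proof -
  interpret pair_graph G by fact
  let ?d = "graph_dist G"
  have le: "?d u v \<le> length p" if "awalk u p v" for u v p
  proof -
    have "ereal (real (?d u v)) = \<mu> (\<lambda>_. 1) u v"
      using graph_dist_conv_mu[OF assms(1) con] V by simp
    also have "\<dots> \<le> awalk_cost (\<lambda>_. 1) p" by (rule min_cost_le_walk_cost[OF that])
    also have "awalk_cost (\<lambda>_. 1) p = real (length p)" by (induction p) auto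
    finally show ?thesis by simp
  qed
  have ex: "\<exists>p. awalk u p v \<and> length p = ?d u v" for u v
  proof -
    have "strongly_connected (with_proj G)"
      using symmetric_connected_imp_strongly_connected pair_sym_arcs con by blast
    then have "u \<rightarrow>\<^sup>*\<^bsub>with_proj G\<^esub> v"
      using V by (simp add: strongly_connected_def)
    then obtain q where "apath u q v"
      using reachable_apath by blast
    \<comment> \<open>Connectedness provides a path, so the \<open>LEAST\<close> is
      attained.\<close>
    then have "\<exists>k p. apath u p v \<and> length p = k" by blast
    then have "\<exists>p. apath u p v \<and> length p = ?d u v"
      unfolding graph_dist_def by (rule LeastI_ex)
    then show ?thesis using awalkI_apath by blast
  qed
  have rev: "\<exists>q. awalk v q u \<and> length q = length p" if "awalk u p v" for u v p
    using that
  proof (induction p arbitrary: u)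
    case Nil
    then show ?case by (auto simp: awalk_Nil_iff)
  next
    case (Cons x p)
    obtain w where x: "x = (u, w)" and "(u, w) \<in> parcs G" and "awalk w p v"
      using Cons.prems by (cases x) (auto simp: awalk_Cons_iff)
    then have "(w, u) \<in> parcs G"
      using pair_sym_arcs by (auto simp: symmetric_def dest: symD)
    then have "awalk w [(w, u)] u" by (simp add: awalk_Cons_iff awalk_Nil_iff V)
    moreover obtain q where "awalk v q w" "length q = length p"
      using Cons.IH \<open>awalk w p v\<close> by blast
    ultimately show ?case
      using awalk_appendI[of v q w "[(w, u)]" u] by (intro exI[of _ "q @ [(w, u)]"]) simp
  qed
  show ?thesis
  proof
    fix u v w k
    show "?d u v = 0 \<longleftrightarrow> u = v"
    proof
      assume "?d u v = 0"
      with ex[of u v] show "u = v" by (auto simp: awalk_Nil_iff)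
    next
      assume "u = v"
      with le[of u "[]" v] show "?d u v = 0" by (simp add: awalk_Nil_iff V)
    qed
    have le_sym: "?d u v \<le> ?d v u" for u v
    proof -
      obtain p where "awalk v p u" "length p = ?d v u" using ex by blast
      moreover from this(1) obtain q where "awalk u q v" "length q = length p" using rev by blast
      ultimately show ?thesis using le[of u q v] by simp
    qed
    show "?d u v = ?d v u" by (intro antisym le_sym)
    show triangle: "?d u w \<le> ?d u v + ?d v w" for u v w
    proof -
      obtain p q where "awalk u p v" "length p = ?d u v" "awalk v q w" "length q = ?d v w"
        using ex by blast
      then show ?thesis using le[OF awalk_appendI, of u p v q w] by simp
    qed
    show "\<exists>w. ?d u w = 1 \<and> ?d w v = k" if k: "?d u v = Suc k"
    proof -
      obtain p where "awalk u p v" "length p = Suc k" using ex[of u v] k by auto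
      then obtain w q where w: "(u, w) \<in> parcs G" "awalk w q v" "length q = k"
        by (cases p) (auto simp: awalk_Cons_iff)
      \<comment> \<open>The first arc and the rest of a shortest walk bound the two distances by 1
        and \<open>k\<close>; the triangle inequality forces equality.\<close>
      then have "?d u w \<le> 1"
        using le[of u "[(u, w)]" w] by (simp add: awalk_Cons_iff awalk_Nil_iff V)
      moreover have "?d w v \<le> k" using le w by blast
      ultimately have "?d u w = 1 \<and> ?d w v = k" using triangle[of u v w] k by linarith
      then show ?thesis by blast
    qed
  qed
qed

section \<open>Counting the eigenvalues below 4\<close>

text \<open>These bounds are sharp enough to order \<open>2 < 1 + sqrt 3 < 3 < (1 + sqrt 33) / 2 <
  (3 + sqrt 17) / 2 < 4\<close>.\<close>

lemma sqrt_3_17_33_bounds: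
  "17 / 10 < sqrt (3::real)" "sqrt (3::real) < 18 / 10"
  "41 / 10 < sqrt (17::real)" "sqrt (17::real) < 42 / 10"
  "57 / 10 < sqrt (33::real)" "sqrt (33::real) < 58 / 10"
  by (rule real_less_rsqrt real_less_lsqrt; simp add: power2_eq_square)+

theorem theorem5p2:
  fixes G :: "'n::finite pair_pre_digraph"
  assumes "pair_graph G"
    and "pverts G = UNIV"
    and "Digraph_Component.connected (with_proj G)"
    and "CARD('n) \<ge> 5"
    and "is_mu G 5 ((3 + sqrt 17) / 2)"
  shows "is_mu G 6 4"
proof -
  interpret graph_metric "graph_dist G"
    using assms(1-3) by (rule graph_metric_graph_dist)
  have ev: "distance_pareto_eigenvalues G = spectrum"
    by (simp add: distance_pareto_eigenvalues_def distance_matrix_def spectrum_def)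
  let ?m = "(3 + sqrt 17) / 2" and ?B = "{0, 1, 2, 1 + sqrt 3}"
  note b = sqrt_3_17_33_bounds
  have m: "?m \<in> spectrum" and fin: "finite {s \<in> spectrum. s < ?m}" and card: "card {s \<in> spectrum. s < ?m} = 4"
    using assms(5) unfolding is_mu_def kth_smallest_def ev by simp_all
  \<comment> \<open>Being none of the other candidates, \<open>?m\<close> can only come from the
    second disjunct of \<open>spectrum_below_4\<close>.\<close>
  have "?m \<notin> {0, 1, 2, 3, 1 + sqrt 3, (1 + sqrt 33) / 2}" "?m < 4"
    using b by auto
  with spectrum_below_4[OF m] have diamond: K4_minus_edge by blast
  then obtain x y z where xyz: "graph_dist G x y = 2" "graph_dist G x z = 1" "graph_dist G y z = 1"
    unfolding K4_minus_edge_def by blast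
  have B: "?B \<subseteq> spectrum"
    using dist_in_spectrum[of x x] dist_in_spectrum[of x y] dist_in_spectrum[of x z]
      triple_112_in_spectrum[OF xyz] xyz by simp
  have card_B: "card ?B = 4" using b by (simp add: card_insert_if)
  have "?B \<subseteq> {s \<in> spectrum. s < ?m}" using B b by auto
  \<comment> \<open>The known four eigenvalues fill all four places below \<open>?m\<close>, which
    excludes 3 and \<open>(1 + sqrt 33) / 2\<close>.\<close>
  from card_subset_eq[OF fin this] have below_m: "{s \<in> spectrum. s < ?m} = ?B"
    unfolding card card_B by (metis refl)
  have "3 \<notin> ?B" "(1 + sqrt 33) / 2 \<notin> ?B" "3 < ?m" "(1 + sqrt 33) / 2 < ?m"
    using b by auto
  then have no: "3 \<notin> spectrum" "(1 + sqrt 33) / 2 \<notin> spectrum"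
    using below_m by blast+
  have "4 \<in> spectrum" using four_in_spectrum[OF diamond assms(4) no] .
  \<comment> \<open>Exactly five eigenvalues precede 4, so 4 is the sixth.\<close>
  have below_4: "{s \<in> spectrum. s < 4} = insert ?m ?B"
  proof
    show "{s \<in> spectrum. s < 4} \<subseteq> insert ?m ?B" using spectrum_below_4 no by blast
    show "insert ?m ?B \<subseteq> {s \<in> spectrum. s < 4}" using B m \<open>?m < 4\<close> b by auto
  qed
  have "?m \<notin> ?B" using b by auto
  then have "card (insert ?m ?B) = Suc (card ?B)"
    by (intro card_insert_disjoint) simp_all
  then have "card (insert ?m ?B) = 5"
    unfolding card_B by simp
  with \<open>4 \<in> spectrum\<close> show ?thesis
    unfolding is_mu_def kth_smallest_def ev below_4 by (simp only: finite.intros) simp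
qed

end
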